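(* Let $M$ be an $n\times n$ symmetric integer matrix, let $M_x = xI_n - M$, and let $k\in\{1,\dots,n\}$. Suppose $\lambda$ is a common root of the polynomials in $I_k^{\mathbb{Z}}(M_x)$. Then $\lambda$ is an eigenvalue of $M$, $\lambda$ is a real number, and $\lambda$ is a factor of $\Delta_k(M)$, with division defined in the ring of algebraic integers (i.e. $\Delta_k(M)=\lambda\mu$ for some algebraic integer $\mu$).
   Context: $I_n$ is the $n\times n$ identity matrix and $x$ an indeterminate. A $k$-minor of a matrix is the determinant of a $k\times k$ submatrix obtained by choosing $k$ rows and $k$ columns. $I_k^{\mathbb{Z}}(M_x)\subseteq\mathbb{Z}[x]$ is the ideal of $\mathbb{Z}[x]$ generated by all $k$-minors of $M_x$ (the $k$-th determinantal ideal). A common root of the polynomials in the ideal is a (complex) number $\lambda$ with $f(\lambda)=0$ for every $f\in I_k^{\mathbb{Z}}(M_x)$. $\Delta_k(M)\in\mathbb{Z}$ is the greatest common divisor of all $k$-minors of $M$ (equal to $0$ if all $k$-minors vanish). *)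

theory Defs
  imports
    "HOL-Algebra.Ideal"
    "Jordan_Normal_Form.Char_Poly"
    "Jordan_Normal_Form.DL_Submatrix"
    "Jordan_Normal_Form.VS_Connect"
begin

definition minors :: "nat \<Rightarrow> 'a :: comm_ring_1 mat \<Rightarrow> 'a set" where
  "minors k A = {det (submatrix A I J) | I J.
     I \<subseteq> {..<dim_row A} \<and> J \<subseteq> {..<dim_col A} \<and> card I = k \<and> card J = k}"

text \<open>\<^term>\<open>class_ring\<close> is the type-class ring viewed as a ring record with carrier
  \<^term>\<open>UNIV\<close>, so this is the ideal of the whole ring \<^typ>\<open>'a\<close> generated by the \<open>k\<close>-minors.\<close>

definition determinantal_ideal :: "nat \<Rightarrow> 'a :: comm_ring_1 mat \<Rightarrow> 'a set" where
  "determinantal_ideal k A = Idl\<^bsub>class_ring\<^esub> (minors k A)"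

text \<open>\<^const>\<open>Gcd\<close> on \<^typ>\<open>int\<close> is the non-negative gcd of a set, and is \<open>0\<close> if all elements are \<open>0\<close>.\<close>

definition minors_gcd :: "nat \<Rightarrow> int mat \<Rightarrow> int" where
  "minors_gcd k M = Gcd (minors k M)"

end

theory Submission
  imports Defs
begin

text \<open>Write \<open>X = xI - M\<close>.  By Laplace expansion the determinantal ideals of \<open>X\<close> form a descending
  chain, so the characteristic polynomial \<open>det X\<close>, being the \<open>n\<close>-minor of \<open>X\<close>, belongs to the
  \<open>k\<close>-th one for every \<open>k \<le> n\<close> (\<open>det_in_determinantal_ideal\<close>).  A common root \<open>z\<close> of that ideal is
  therefore an eigenvalue of \<open>M\<close>, and it is real because \<open>M\<close> is real and symmetric.

  For the divisibility, let \<open>f\<close> be a \<open>k\<close>-minor of \<open>X\<close>.  Setting \<open>x = 0\<close> turns \<open>X\<close> into \<open>-M\<close>, so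
  \<open>f(0)\<close> is, up to sign, the corresponding \<open>k\<close>-minor of \<open>M\<close>.  On the other hand \<open>f(z) = 0\<close>, hence
  \<open>f(0) = f(0) - f(z)\<close> is a multiple of \<open>z\<close> in \<open>\<int>[z]\<close>.  Thus \<open>z\<close> divides every \<open>k\<close>-minor of \<open>M\<close> in
  \<open>\<int>[z]\<close>, and by Bezout also their gcd.  Finally \<open>\<int>[z]\<close> consists of algebraic integers, since
  \<open>g(z)\<close> is an eigenvalue of the integer matrix \<open>g(M)\<close> (\<open>algebraic_int_poly_eigenvalue\<close>).\<close>

section \<open>The descending chain of determinantal ideals\<close>

lemma finite_minors: "finite (minors k A)"
proof -
  have "minors k A \<subseteq>
      (\<lambda>(I, J). det (submatrix A I J)) ` (Pow {..<dim_row A} \<times> Pow {..<dim_col A})"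
    unfolding minors_def by auto
  then show ?thesis
    by (rule finite_subset) auto
qed

lemma minors_subset_determinantal_ideal: "minors k A \<subseteq> determinantal_ideal k A"
  unfolding determinantal_ideal_def
  by (rule ring.genideal_self[OF class_ring.ring_axioms]) simp

lemma ideal_determinantal_ideal: "ideal (determinantal_ideal k A) class_ring"
  unfolding determinantal_ideal_def
  by (rule ring.genideal_ideal[OF class_ring.ring_axioms]) simp

lemma determinantal_ideal_sum:
  assumes "\<And>i. i \<in> S \<Longrightarrow> f i \<in> determinantal_ideal k A"
  shows "(\<Sum>i\<in>S. c i * f i) \<in> determinantal_ideal k A"
proof -
  interpret ideal "determinantal_ideal k A" class_ring
    by (rule ideal_determinantal_ideal)
  show ?thesis
    using assms
  proof (induction S rule: infinite_finite_induct)
    case (insert i S)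
    have "c i * f i \<in> determinantal_ideal k A"
      using I_l_closed[of "f i" "c i"] insert.prems by simp
    moreover have "(\<Sum>i\<in>S. c i * f i) \<in> determinantal_ideal k A"
      using insert by simp
    ultimately show ?case
      using a_closed insert.hyps by simp
  qed (use zero_closed in simp_all)
qed

text \<open>Removing the element at position \<open>i\<close> moves the later elements down by one position.  The
  position of an element is the number of smaller elements, and this number is what changes
  when an element is removed.  The index shift is the one by which \<^const>\<open>mat_delete\<close> skips a row or
  a column.\<close>

lemma pick_Diff_pick:
  assumes S: "finite S" "card S = Suc k" and i: "i < Suc k" and j: "j < k"
  shows "pick (S - {pick S i}) j = pick S (if j < i then j else Suc j)"
proof -
  define j' where "j' = (if j < i then j else Suc j)"
  define a where "a = pick S j'"
  define p where "p = pick S i"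
  have j': "j' < card S" "j' \<noteq> i" and i': "i < card S"
    using S i j by (auto simp: j'_def)
  have a: "a \<in> S" and p: "p \<in> S" and card_a: "card {b \<in> S. b < a} = j'"
    using pick_in_set[of j' S] pick_in_set[of i S] card_pick[of j' S] j' i'
    by (auto simp: a_def p_def)
  have less: "p < a \<longleftrightarrow> i < j'" and neq: "a \<noteq> p"
    using pick_mono[of i S j'] pick_mono[of j' S i] j' i'
    by (cases "i < j'"; force simp: a_def p_def)+
  have "card {b \<in> S - {p}. b < a} = j"
  proof (cases "p < a")
    case True
    have "{b \<in> S - {p}. b < a} = {b \<in> S. b < a} - {p}"
      by auto
    then have "card {b \<in> S - {p}. b < a} = j' - 1"
      using True p S card_a by simp
    then show ?thesis
      using True less by (auto simp: j'_def split: if_splits)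
  next
    case False
    then have "{b \<in> S - {p}. b < a} = {b \<in> S. b < a}"
      by auto
    then show ?thesis
      using False less j' card_a by (auto simp: j'_def split: if_splits)
  qed
  then show ?thesis
    using pick_card_in_set[of a "S - {p}"] a neq by (simp add: a_def p_def j'_def)
qed

lemma submatrix_carrier:
  assumes "I \<subseteq> {..<dim_row A}" "J \<subseteq> {..<dim_col A}"
  shows "submatrix A I J \<in> carrier_mat (card I) (card J)"
proof -
  have "{i. i < dim_row A \<and> i \<in> I} = I" "{j. j < dim_col A \<and> j \<in> J} = J"
    using assms by auto
  then show ?thesis
    by (intro carrier_matI) (simp_all only: dim_submatrix)
qed

lemma submatrix_nth:
  assumes "I \<subseteq> {..<dim_row A}" "J \<subseteq> {..<dim_col A}" "i < card I" "j < card J"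
  shows "submatrix A I J $$ (i, j) = A $$ (pick I i, pick J j)"
proof -
  have "{i. i < dim_row A \<and> i \<in> I} = I" "{j. j < dim_col A \<and> j \<in> J} = J"
    using assms by auto
  then show ?thesis
    using submatrix_index[of i A I j J] assms by simp
qed

lemma mat_delete_submatrix:
  assumes I: "I \<subseteq> {..<dim_row A}" "card I = Suc k"
    and J: "J \<subseteq> {..<dim_col A}" "card J = Suc k"
    and i: "i < Suc k" and j: "j < Suc k"
  shows "mat_delete (submatrix A I J) i j = submatrix A (I - {pick I i}) (J - {pick J j})"
proof -
  let ?I = "I - {pick I i}" and ?J = "J - {pick J j}"
  have fin: "finite I" "finite J"
    using I J finite_subset by auto
  have card: "card ?I = k" "card ?J = k"
    using I J i j fin pick_in_set[of i I] pick_in_set[of j J] by auto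
  have C: "submatrix A I J \<in> carrier_mat (Suc k) (Suc k)"
    using submatrix_carrier[OF I(1) J(1)] I J by simp
  have sub: "?I \<subseteq> {..<dim_row A}" "?J \<subseteq> {..<dim_col A}"
    using I J by auto
  have D: "submatrix A ?I ?J \<in> carrier_mat k k"
    using submatrix_carrier[OF sub] card by simp
  show ?thesis
  proof (rule eq_matI)
    fix r c assume "r < dim_row (submatrix A ?I ?J)" "c < dim_col (submatrix A ?I ?J)"
    then have r: "r < k" and c: "c < k"
      using D by auto
    have "mat_delete (submatrix A I J) i j $$ (r, c)
        = submatrix A I J $$ (if r < i then r else Suc r, if c < j then c else Suc c)"
      using r c C by (simp add: mat_delete_def)
    also have "\<dots> = A $$ (pick I (if r < i then r else Suc r), pick J (if c < j then c else Suc c))"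
      by (rule submatrix_nth) (use I J r c in auto)
    also have "\<dots> = submatrix A ?I ?J $$ (r, c)"
      using pick_Diff_pick[OF fin(1) I(2) i r] pick_Diff_pick[OF fin(2) J(2) j c]
        submatrix_nth[OF sub, of r c] card r c by simp
    finally show "mat_delete (submatrix A I J) i j $$ (r, c) = submatrix A ?I ?J $$ (r, c)" .
  qed (use C D in auto)
qed

text \<open>This is Laplace expansion along the first column, whose cofactors are signed minors of the
  next smaller size by \<open>mat_delete_submatrix\<close>.\<close>

lemma minors_Suc_subset_determinantal_ideal: "minors (Suc k) A \<subseteq> determinantal_ideal k A"
proof
  fix d assume "d \<in> minors (Suc k) A"
  then obtain I J where d: "d = det (submatrix A I J)"
    and I: "I \<subseteq> {..<dim_row A}" "card I = Suc k"
    and J: "J \<subseteq> {..<dim_col A}" "card J = Suc k"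
    unfolding minors_def by auto
  let ?B = "submatrix A I J"
  have "?B \<in> carrier_mat (Suc k) (Suc k)"
    using submatrix_carrier[OF I(1) J(1)] I J by simp
  then have "det ?B = (\<Sum>i<Suc k. ?B $$ (i, 0) * cofactor ?B i 0)"
    by (rule laplace_expansion_column) simp
  then have d_eq: "d = (\<Sum>i<Suc k. (?B $$ (i, 0) * (-1) ^ (i + 0)) * det (mat_delete ?B i 0))"
    by (simp only: d cofactor_def mult.assoc)
  show "d \<in> determinantal_ideal k A"
    unfolding d_eq
  proof (rule determinantal_ideal_sum)
    fix i assume "i \<in> {..<Suc k}"
    then have i: "i < Suc k" by simp
    have "card (I - {pick I i}) = k" "card (J - {pick J 0}) = k"
      using I J i pick_in_set[of i I] pick_in_set[of 0 J] by auto
    then have "det (mat_delete ?B i 0) \<in> minors k A"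
      unfolding mat_delete_submatrix[OF I J i zero_less_Suc] minors_def
      using I(1) J(1) by blast
    then show "det (mat_delete ?B i 0) \<in> determinantal_ideal k A"
      using minors_subset_determinantal_ideal by blast
  qed
qed

lemma determinantal_ideal_antimono:
  assumes "k \<le> m"
  shows "determinantal_ideal m A \<subseteq> determinantal_ideal k A"
  using assms
proof (induction m rule: dec_induct)
  case (step m)
  have "determinantal_ideal (Suc m) A \<subseteq> determinantal_ideal m A"
    unfolding determinantal_ideal_def[of "Suc m"]
    by (rule ring.genideal_minimal[OF class_ring.ring_axioms ideal_determinantal_ideal
          minors_Suc_subset_determinantal_ideal])
  with step.IH show ?case by blast
qed simp

lemma det_in_determinantal_ideal:
  assumes A: "A \<in> carrier_mat n n" and "k \<le> n"
  shows "det A \<in> determinantal_ideal k A"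
proof -
  have pick_id: "pick {..<n} i = i" if "i < n" for i
  proof -
    have "{a \<in> {..<n}. a < i} = {..<i}"
      using that by auto
    then show ?thesis
      using pick_card_in_set[of i "{..<n}"] that by simp
  qed
  have sub: "submatrix A {..<n} {..<n} = A"
    using A submatrix_carrier[of "{..<n}" A "{..<n}"] submatrix_nth[of "{..<n}" A "{..<n}"]
    by (intro eq_matI) (auto simp: pick_id)
  then have "det A \<in> minors n A"
    unfolding minors_def mem_Collect_eq using A
    by (intro exI[of _ "{..<n}"] conjI sub[THEN arg_cong, symmetric]) simp_all
  then show ?thesis
    using minors_subset_determinantal_ideal determinantal_ideal_antimono[OF \<open>k \<le> n\<close>] by blast
qed

section \<open>Eigenvalues of integer matrices\<close>

text \<open>The monic integer polynomial that annihilates the eigenvalue is the characteristic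
  polynomial.\<close>

lemma algebraic_int_eigenvalue:
  fixes z :: "'a :: field_char_0"
  assumes A: "A \<in> carrier_mat n n" and ev: "eigenvalue (map_mat of_int A) z"
  shows "algebraic_int z"
  unfolding algebraic_int_altdef_ipoly
proof (intro exI conjI)
  have "map_mat of_int A \<in> carrier_mat n n"
    using A by simp
  then show "poly (map_poly of_int (char_poly A)) z = 0"
    using ev eigenvalue_root_char_poly of_int_hom.char_poly_hom[OF A] by metis
  show "lead_coeff (char_poly A) = 1"
    using degree_monic_char_poly[OF A] by simp
qed

text \<open>The algebraic integers contain \<open>\<int>[z]\<close> for every eigenvalue \<open>z\<close> of an integer matrix \<open>A\<close>,
  because every eigenvector of \<open>A\<close> for \<open>z\<close> is an eigenvector of the integer matrix \<open>g(A)\<close>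
  for \<open>g(z)\<close>.\<close>

lemma algebraic_int_poly_eigenvalue:
  fixes z :: "'a :: field_char_0" and g :: "int poly"
  assumes A: "A \<in> carrier_mat n n" and ev: "eigenvalue (map_mat of_int A) z"
  shows "algebraic_int (poly (map_poly of_int g) z)"
proof -
  from ev A obtain v where v: "v \<in> carrier_vec n" "v \<noteq> 0\<^sub>v n"
    and Av: "map_mat of_int A *\<^sub>v v = z \<cdot>\<^sub>v v"
    unfolding eigenvalue_def eigenvector_def by auto
  \<comment> \<open>The matrix \<open>B\<close> is \<open>g(A)\<close>, built by Horner's scheme.\<close>
  have "\<exists>B \<in> carrier_mat n n.
      map_mat of_int B *\<^sub>v v = poly (map_poly of_int g) z \<cdot>\<^sub>v v"
  proof (induction g)
    case 0
    show ?case
      using v by (intro bexI[of _ "0\<^sub>m n n"]) (auto intro!: eq_vecI simp: scalar_prod_def)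
  next
    case (pCons a g)
    then obtain B where B: "B \<in> carrier_mat n n"
      and Bv: "map_mat of_int B *\<^sub>v v = poly (map_poly of_int g) z \<cdot>\<^sub>v v"
      by blast
    let ?h = "map_mat of_int :: int mat \<Rightarrow> 'a mat"
    define C where "C = a \<cdot>\<^sub>m 1\<^sub>m n + A * B"
    have C: "C \<in> carrier_mat n n"
      using A B by (simp add: C_def)
    have "?h C = of_int a \<cdot>\<^sub>m 1\<^sub>m n + ?h (A * B)"
      using A B by (intro eq_matI) (auto simp: C_def)
    then have "?h C = of_int a \<cdot>\<^sub>m 1\<^sub>m n + ?h A * ?h B"
      unfolding of_int_hom.mat_hom_mult[OF A B] .
    moreover have "(?h A * ?h B) *\<^sub>v v = poly (map_poly of_int g) z \<cdot>\<^sub>v (z \<cdot>\<^sub>v v)"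
      using A B v Av Bv
      by (simp add: assoc_mult_mat_vec[of _ n n _ n] mult_mat_vec[of _ n n])
    moreover have "(of_int a \<cdot>\<^sub>m 1\<^sub>m n) *\<^sub>v v = of_int a \<cdot>\<^sub>v v"
      using v by (intro eq_vecI) auto
    ultimately have "?h C *\<^sub>v v = of_int a \<cdot>\<^sub>v v + poly (map_poly of_int g) z \<cdot>\<^sub>v (z \<cdot>\<^sub>v v)"
      using A B v by (simp add: add_mult_distrib_mat_vec[of _ n n])
    also have "\<dots> = poly (map_poly of_int (pCons a g)) z \<cdot>\<^sub>v v"
      using v by (intro eq_vecI) (auto simp: of_int_hom.map_poly_pCons_hom algebra_simps)
    finally show ?case
      using C by blast
  qed
  then obtain B where B: "B \<in> carrier_mat n n"
    and "map_mat of_int B *\<^sub>v v = poly (map_poly of_int g) z \<cdot>\<^sub>v v"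
    by blast
  then have "eigenvalue (map_mat of_int B) (poly (map_poly of_int g) z)"
    unfolding eigenvalue_def eigenvector_def using v by (intro exI[of _ v]) auto
  then show ?thesis
    by (rule algebraic_int_eigenvalue[OF B])
qed

text \<open>For an eigenvector \<open>v\<close>, both \<open>z\<close> and its conjugate are the quotient of
  \<open>v\<^sup>* A v\<close> by the nonzero number \<open>v\<^sup>* v\<close>.\<close>

lemma eigenvalue_hermitian_real:
  fixes A :: "complex mat"
  assumes A: "A \<in> carrier_mat n n" and herm: "transpose_mat A = map_mat cnj A"
    and ev: "eigenvalue A z"
  shows "z \<in> \<real>"
proof -
  from ev A obtain v where v: "v \<in> carrier_vec n" "v \<noteq> 0\<^sub>v n" and Av: "A *\<^sub>v v = z \<cdot>\<^sub>v v"
    unfolding eigenvalue_def eigenvector_def by auto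
  let ?w = "conjugate v"
  have w: "?w \<in> carrier_vec n"
    using v by simp
  have "map_mat cnj A *\<^sub>v ?w = conjugate (A *\<^sub>v v)"
    using A v by (intro eq_vecI) (auto simp: scalar_prod_def)
  then have Aw: "transpose_mat A *\<^sub>v ?w = cnj z \<cdot>\<^sub>v ?w"
    using Av herm by (auto simp: conjugate_smult_vec)
  have "z * (v \<bullet> ?w) = (A *\<^sub>v v) \<bullet> ?w"
    using v w Av by simp
  also have "\<dots> = ?w \<bullet> (A *\<^sub>v v)"
    using A v w by (intro comm_scalar_prod[of _ n]) auto
  also have "\<dots> = (transpose_mat A *\<^sub>v ?w) \<bullet> v"
    using transpose_vec_mult_scalar[OF A v(1) w] by simp
  also have "\<dots> = cnj z * (?w \<bullet> v)"
    using v w Aw by simp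
  also have "?w \<bullet> v = v \<bullet> ?w"
    using v w by (intro comm_scalar_prod[of _ n]) auto
  finally have "z = cnj z"
    using conjugate_square_eq_0_vec[OF v(1)] v(2) by simp
  then show ?thesis
    by (simp add: Reals_cnj_iff)
qed

section \<open>Divisibility of the gcd of the minors\<close>

text \<open>By Bezout, the gcd of finitely many integers is an integer combination of them.\<close>

lemma Gcd_int_closed:
  fixes A S :: "int set"
  assumes "finite A" "A \<subseteq> S" "0 \<in> S"
    and lin: "\<And>a b u v. a \<in> S \<Longrightarrow> b \<in> S \<Longrightarrow> u * a + v * b \<in> S"
  shows "Gcd A \<in> S"
  using assms(1,2)
proof (induction A rule: finite_induct)
  case empty
  then show ?case using assms(3) by simp
next
  case (insert a A)
  obtain u v where "u * a + v * Gcd A = gcd a (Gcd A)"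
    using bezout_int by blast
  then show ?case
    using lin[of a "Gcd A" u v] insert by simp
qed

text \<open>Splitting off the constant coefficient, \<open>f = a + x g\<close> gives \<open>a = -z g(z)\<close> at a
  root \<open>z\<close>.\<close>

lemma constant_coeff_multiple_of_root:
  fixes z :: "'a :: comm_ring_1" and f :: "int poly"
  assumes "poly (map_poly of_int f) z = 0"
  shows "\<exists>g. of_int (poly f 0) = z * poly (map_poly of_int g) z"
proof -
  obtain a g where f: "f = pCons a g"
    by (cases f)
  have "of_int a = z * poly (map_poly of_int (- g)) z"
    using assms by (simp add: f of_int_hom.map_poly_pCons_hom of_int_poly_hom.hom_uminus
        eq_neg_iff_add_eq_0)
  then show ?thesis
    using f by auto
qed

text \<open>At \<open>x = 0\<close> the matrix \<open>xI - M\<close> becomes \<open>-M\<close>; the sign comes out of each of the \<open>k\<close> rows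
  of the submatrix.\<close>

lemma poly_0_det_submatrix_char_poly_matrix:
  assumes M: "M \<in> carrier_mat n n"
    and I: "I \<subseteq> {..<n}" "card I = k" and J: "J \<subseteq> {..<n}" "card J = k"
  shows "poly (det (submatrix (char_poly_matrix M) I J)) 0 = (-1) ^ k * det (submatrix M I J)"
proof -
  have X: "char_poly_matrix M \<in> carrier_mat n n"
    using M by simp
  have sM: "submatrix M I J \<in> carrier_mat k k"
    using submatrix_carrier[of I M J] M I J by simp
  have sX: "submatrix (char_poly_matrix M) I J \<in> carrier_mat k k"
    using submatrix_carrier[of I "char_poly_matrix M" J] X I J by simp
  have "poly (det (submatrix (char_poly_matrix M) I J)) 0 = det ((-1) \<cdot>\<^sub>m submatrix M I J)"
  proof (rule poly_det_cong[OF _ sX])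
    fix i j assume ij: "i < k" "j < k"
    then have "pick I i < n" "pick J j < n"
      using pick_in_set[of i I] pick_in_set[of j J] I J by auto
    then show "poly (submatrix (char_poly_matrix M) I J $$ (i, j)) 0
        = ((-1) \<cdot>\<^sub>m submatrix M I J) $$ (i, j)"
      using ij I J M sM X submatrix_nth[of I "char_poly_matrix M" J i j]
        submatrix_nth[of I M J i j]
      by (simp add: char_poly_matrix_def)
  qed (use sM in simp)
  then show ?thesis
    using sM by simp
qed

theorem theorem22:
  fixes M :: "int mat" and n k :: nat and z :: complex
  assumes "M \<in> carrier_mat n n"
    and "transpose_mat M = M"
    and "k \<in> {1..n}"
    and "\<forall>f \<in> determinantal_ideal k ([:0, 1:] \<cdot>\<^sub>m 1\<^sub>m n - map_mat (\<lambda>a. [:a:]) M :: int poly mat).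
           poly (map_poly of_int f) z = 0"
  shows "eigenvalue (map_mat of_int M) z
       \<and> z \<in> \<real>
       \<and> (\<exists>\<mu>. algebraic_int \<mu> \<and> of_int (minors_gcd k M) = z * \<mu>)"
proof -
  note M = assms(1)
  let ?X = "char_poly_matrix M"
  let ?ev = "\<lambda>f :: int poly. poly (map_poly of_int f) z"
  have X: "?X \<in> carrier_mat n n"
    using M by simp
  have "[:0, 1:] \<cdot>\<^sub>m 1\<^sub>m n - map_mat (\<lambda>a. [:a:]) M = ?X"
    using M by (intro eq_matI) (auto simp: char_poly_matrix_def)
  then have root: "?ev f = 0" if "f \<in> determinantal_ideal k ?X" for f
    using assms(4) that by simp

  have "char_poly M \<in> determinantal_ideal k ?X"
    unfolding char_poly_def using assms(3) by (intro det_in_determinantal_ideal[OF X]) auto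
  then have "poly (char_poly (map_mat of_int M)) z = 0"
    using root of_int_hom.char_poly_hom[OF M] by metis
  then have ev: "eigenvalue (map_mat of_int M) z"
    using eigenvalue_root_char_poly[of "map_mat of_int M" n z] M by simp

  have "transpose_mat (map_mat of_int M :: complex mat) = map_mat of_int (transpose_mat M)"
    by (intro eq_matI) auto
  then have "transpose_mat (map_mat of_int M) = map_mat cnj (map_mat of_int M)"
    unfolding assms(2) by (auto intro!: eq_matI)
  then have real: "z \<in> \<real>"
    using eigenvalue_hermitian_real[of "map_mat of_int M" n z] M ev by simp

  \<comment> \<open>\<open>S\<close> consists of the integers that \<open>z\<close> divides in \<open>\<int>[z]\<close>.\<close>
  define S where "S = {a :: int. \<exists>g. of_int a = z * ?ev g}"
  have lin: "u * a + v * b \<in> S" if ab: "a \<in> S" "b \<in> S" for a b u v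
  proof -
    obtain g h where "of_int a = z * ?ev g" "of_int b = z * ?ev h"
      using ab unfolding S_def by blast
    then have "of_int (u * a + v * b) = z * ?ev (Polynomial.smult u g + Polynomial.smult v h)"
      by (simp add: of_int_hom.map_poly_hom_smult of_int_poly_hom.hom_add algebra_simps)
    then show ?thesis
      unfolding S_def by blast
  qed
  have "0 \<in> S"
    unfolding S_def by (auto intro: exI[of _ 0])
  have "minors k M \<subseteq> S"
  proof
    fix d assume "d \<in> minors k M"
    then obtain I J where d: "d = det (submatrix M I J)"
      and IJ: "I \<subseteq> {..<n}" "card I = k" "J \<subseteq> {..<n}" "card J = k"
      using M unfolding minors_def by auto
    let ?f = "det (submatrix ?X I J)"
    have "?f \<in> minors k ?X"
      using IJ X unfolding minors_def by auto
    then have "?ev ?f = 0"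
      using root minors_subset_determinantal_ideal by blast
    then have "poly ?f 0 \<in> S"
      unfolding S_def using constant_coeff_multiple_of_root by blast
    then have "(-1) ^ k * d \<in> S"
      using poly_0_det_submatrix_char_poly_matrix[OF M IJ] d by simp
    from lin[OF this \<open>0 \<in> S\<close>, of "(-1) ^ k" 0] show "d \<in> S"
      by (simp flip: mult.assoc power_mult_distrib)
  qed
  then have "minors_gcd k M \<in> S"
    unfolding minors_gcd_def using finite_minors \<open>0 \<in> S\<close> lin by (intro Gcd_int_closed)
  then obtain g where "of_int (minors_gcd k M) = z * ?ev g"
    unfolding S_def by blast
  moreover have "algebraic_int (?ev g)"
    by (rule algebraic_int_poly_eigenvalue[OF M ev])
  ultimately show ?thesis
    using ev real by blast
qed

end
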